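(* Let $G$ be an $n$-node graph with two agents initially situated at distance $D\ge 1$ from one another, with distinct labels $\ell_1,\ell_2\in\{1,\dots,L\}$. Algorithm Fast Rendezvous (described in the context), using the advice string $\mathcal{A}$ described in the context, achieves rendezvous in time $D$, and the advice has size $O(D\log(n/D)+\log\log L)$.
   Context: Rendezvous model: the network is an undirected connected graph with $n$ nodes; nodes are unlabeled. At each node $v$ of degree $d$, the incident edges carry distinct port numbers $0,\dots,d-1$ (local numbering, no relation between the two endpoints of an edge). Two agents start at different nodes and move in synchronous rounds: in each round an agent either stays or chooses a port and moves along the corresponding edge. On entering a node an agent learns its degree and the entry port. Agents cannot mark nodes, cannot communicate before meeting, and do not notice crossing inside an edge. Each agent has a distinct label from $\{1,\dots,L\}$, knows its own label but not the other's. The adversary wakes the agents possibly in different rounds; each starts the algorithm at its wake-up. Both run the same deterministic algorithm with inputs its own label and an advice string given identically to both agents by an oracle knowing the whole instance (graph, port numbering, starting positions, wake-up rounds, both labels); the size of advice is the length of this binary string. Rendezvous means both agents at the same node in the same round; time is the number of rounds from the wake-up of the later agent until the meeting. Advice construction: let $x$ be the smallest index such that the binary representations of $\ell_1$ and $\ell_2$ differ on the $x$-th bit; call the agent whose label has bit $1$ at position $x$ the second agent and the other the first agent. Fix a shortest path $P$ from the initial position of the second agent to the initial position of the first agent, and let $(p_1,\dots,p_D)$ be the sequence of ports to be taken at consecutive nodes of $P$ to follow it in that direction. Let $A_0$ be the binary representation of $x$ and $A_i$ the binary representation of $p_i$ for $i=1,\dots,D$. The advice $\mathcal{A}=Concat(A_0,\dots,A_D)$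 is obtained by doubling each bit of each $A_i$ and inserting the separator $01$ between consecutive substrings (e.g. $Concat((01),(00))=(0011010000)$); $Decode$ denotes the inverse map. Algorithm Fast Rendezvous (input: advice $\mathcal{A}$, own label $\ell$): compute $(A_0,\dots,A_D)=Decode(\mathcal{A})$ and let $x$ be the integer represented by $A_0$. If the $x$-th bit of $\ell$ is $1$, then for $i=1,\dots,D$ take port $p_i$, the integer represented by $A_i$; then stop. (If the bit is $0$, the agent stays at its initial position.)
   Formalization: The bound is proved with max(1, log(n/D)) in place of log(n/D): read literally, O(D log(n/D) + log log L) fails for agents at the two ends of an n-node path with L = 2, where it stays bounded while the advice has at least 4D bits. *)

theory Defs
  imports Complex_Main "Graph_Theory.Graph_Theory"
begin

section \<open>Port-labelled graphs\<close>

text \<open>An undirected edge between \<open>u\<close> and \<open>v\<close> is the pair of arcs \<open>(u, v)\<close>, \<open>(v, u)\<close>; the two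
  port numbers of the edge are the values of \<open>port\<close> on these arcs.\<close>

locale port_graph = pair_graph G for G :: "'v pair_pre_digraph" +
  fixes port :: "'v \<times> 'v \<Rightarrow> nat"
  assumes connected: "connected (with_proj G)"
    and bij_port: "v \<in> pverts G \<Longrightarrow>
      bij_betw port (out_arcs (with_proj G) v) {..<out_degree (with_proj G) v}"

definition port_target :: "'v pair_pre_digraph \<Rightarrow> ('v \<times> 'v \<Rightarrow> nat) \<Rightarrow> 'v \<Rightarrow> nat \<Rightarrow> 'v" where
  "port_target G port v p = snd (THE e. e \<in> out_arcs (with_proj G) v \<and> port e = p)"

definition graph_dist :: "'v pair_pre_digraph \<Rightarrow> 'v \<Rightarrow> 'v \<Rightarrow> ereal" where
  "graph_dist G u v = wf_digraph.\<mu> (with_proj G) (\<lambda>_. 1) u v"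

definition shortest_path :: "'v pair_pre_digraph \<Rightarrow> 'v \<Rightarrow> ('v \<times> 'v) list \<Rightarrow> 'v \<Rightarrow> bool" where
  "shortest_path G u P v \<longleftrightarrow>
     pre_digraph.apath (with_proj G) u P v \<and> graph_dist G u v = ereal (real (length P))"


section \<open>Agents, algorithms and executions\<close>

record 'v agent =
  start :: 'v
  label :: nat
  wake :: nat

datatype action = Stay | Move nat

text \<open>A percept is the degree of the current node together with the port by which the agent has
  just entered it; the second component is \<^term>\<open>None\<close> at wake-up and after a round spent in place.
  A deterministic algorithm chooses the action of a round from the own label, the advice and the
  percepts collected so far, oldest first; in the \<open>k\<close>-th round after wake-up (counted from 0) this
  list has length \<open>k + 1\<close>.\<close>

type_synonym percept = "nat \<times> nat option"
type_synonym algorithm = "nat \<Rightarrow> bool list \<Rightarrow> percept list \<Rightarrow> action"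

text \<open>Position and percepts after \<open>k\<close> rounds of own activity. Choosing a port that does not exist
  at the current node counts as staying.\<close>

primrec run :: "'v pair_pre_digraph \<Rightarrow> ('v \<times> 'v \<Rightarrow> nat) \<Rightarrow> algorithm \<Rightarrow> bool list \<Rightarrow> 'v agent \<Rightarrow>
    nat \<Rightarrow> 'v \<times> percept list" where
  "run G port alg adv a 0 = (start a, [(out_degree (with_proj G) (start a), None)])"
| "run G port alg adv a (Suc k) =
    (let (v, h) = run G port alg adv a k; d = out_degree (with_proj G) v;
         stay = (v, h @ [(d, None)]) in
     case alg (label a) adv h of
       Stay \<Rightarrow> stay
     | Move p \<Rightarrow>
         if p < d
         then let u = port_target G port v p
              in (u, h @ [(out_degree (with_proj G) u, Some (port (u, v)))])
         else stay)"

text \<open>Position at the beginning of round \<open>t\<close> of the global clock; truncated subtraction keeps an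
  agent that is still asleep at its initial node.\<close>

definition position :: "'v pair_pre_digraph \<Rightarrow> ('v \<times> 'v \<Rightarrow> nat) \<Rightarrow> algorithm \<Rightarrow> bool list \<Rightarrow>
    'v agent \<Rightarrow> nat \<Rightarrow> 'v" where
  "position G port alg adv a t = fst (run G port alg adv a (t - wake a))"

text \<open>Time runs from the wake-up of the later agent, and the agents must share a node at or after
  that moment: merely passing through the node of a sleeping agent does not count.\<close>

definition rendezvous_in_time :: "'v pair_pre_digraph \<Rightarrow> ('v \<times> 'v \<Rightarrow> nat) \<Rightarrow> algorithm \<Rightarrow>
    bool list \<Rightarrow> 'v agent \<Rightarrow> 'v agent \<Rightarrow> nat \<Rightarrow> bool" where
  "rendezvous_in_time G port alg adv a b T \<longleftrightarrow>
     (\<exists>t. max (wake a) (wake b) \<le> t \<and> t \<le> max (wake a) (wake b) + T \<and>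
        position G port alg adv a t = position G port alg adv b t)"


section \<open>Bit strings\<close>

text \<open>Most significant bit first, without leading zeros; the representation of 0 is the single
  bit 0.\<close>

fun binary :: "nat \<Rightarrow> bool list" where
  "binary n = (if n < 2 then [odd n] else binary (n div 2) @ [odd n])"

declare binary.simps [simp del]

definition nat_of_binary :: "bool list \<Rightarrow> nat" where
  "nat_of_binary bs = horner_sum of_bool 2 (rev bs)"

lemma nat_of_binary_binary: "nat_of_binary (binary n) = n"
proof (induction n rule: binary.induct)
  case (1 n)
  show ?case
  proof (cases "n < 2")
    case True
    then have "n = 0 \<or> n = 1" by auto
    then show ?thesis
      by (elim disjE) (simp_all add: binary.simps [of 0] binary.simps [of "Suc 0"] nat_of_binary_def)
  next
    case False
    with 1 have "nat_of_binary (binary (n div 2)) = n div 2" by blast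
    with False show ?thesis
      by (subst binary.simps) (simp add: nat_of_binary_def)
  qed
qed

definition double_bits :: "bool list \<Rightarrow> bool list" where
  "double_bits bs = concat (map (\<lambda>b. [b, b]) bs)"

fun Concat :: "bool list list \<Rightarrow> bool list" where
  "Concat [] = []"
| "Concat [A] = double_bits A"
| "Concat (A # B # As) = double_bits A @ [False, True] @ Concat (B # As)"

fun Decode :: "bool list \<Rightarrow> bool list list" where
  "Decode (False # True # bs) = [] # Decode bs"
| "Decode (b # _ # bs) = (b # hd (Decode bs)) # tl (Decode bs)"
| "Decode _ = [[]]"

lemma "Concat [[False, True], [False, False]] =
    [False, False, True, True, False, True, False, False, False, False]"
  by (simp add: double_bits_def)

lemma Decode_double_bits_append:
  "Decode (double_bits A @ bs) = (A @ hd (Decode bs)) # tl (Decode bs)"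
proof (induction A)
  case Nil
  have "Decode bs \<noteq> []" by (induction bs rule: Decode.induct) auto
  then show ?case by (simp add: double_bits_def)
next
  case (Cons b A)
  then show ?case by (cases b) (simp_all add: double_bits_def)
qed

lemma Decode_Concat: "As \<noteq> [] \<Longrightarrow> Decode (Concat As) = As"
proof (induction As rule: Concat.induct)
  case (2 A)
  show ?case using Decode_double_bits_append [of A "[]"] by simp
qed (simp_all add: Decode_double_bits_append)


section \<open>The advice and Algorithm Fast Rendezvous\<close>

text \<open>Bit positions are counted from 0 at the least significant bit, so that labels of different
  lengths are compared as if padded with leading zeros.\<close>

definition diff_index :: "nat \<Rightarrow> nat \<Rightarrow> nat" where
  "diff_index l1 l2 = (LEAST x. bit l1 x \<noteq> bit l2 x)"

definition first_agent :: "'v agent \<Rightarrow> 'v agent \<Rightarrow> 'v agent" where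
  "first_agent a b = (if bit (label a) (diff_index (label a) (label b)) then b else a)"

definition second_agent :: "'v agent \<Rightarrow> 'v agent \<Rightarrow> 'v agent" where
  "second_agent a b = (if bit (label a) (diff_index (label a) (label b)) then a else b)"

definition advice :: "('v \<times> 'v \<Rightarrow> nat) \<Rightarrow> 'v agent \<Rightarrow> 'v agent \<Rightarrow> ('v \<times> 'v) list \<Rightarrow> bool list" where
  "advice port a b P =
     Concat (binary (diff_index (label a) (label b)) # map (\<lambda>e. binary (port e)) P)"

definition fast_rendezvous :: algorithm where
  "fast_rendezvous l adv h =
     (let As = Decode adv;
          x = nat_of_binary (hd As);
          ps = map nat_of_binary (tl As);
          k = length h - 1
      in if bit l x \<and> k < length ps then Move (ps ! k) else Stay)"

end

theory Submission
  imports Defs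
begin

text \<open>The second agent walks along \<open>P\<close> while the other one waits at its end, so only the length of
  the advice needs an argument. A node has neighbours only among three consecutive vertices of a
  shortest path, as otherwise there would be a shortcut; hence the degrees along \<open>P\<close> add up to
  at most \<open>3 n\<close>. By concavity of the logarithm, the \<open>D\<close> ports take
  \<open>O(D + D log (n / D))\<close> bits in total.\<close>

section \<open>Length of the bit strings\<close>

text \<open>For positive \<open>m\<close> the leading bit is 1, so \<open>k\<close> bits force
  \<open>m\<close> to be at least \<open>2 ^ (k - 1)\<close>; the factor 2 avoids the
  subtraction.\<close>

lemma power_length_binary_le: "0 < m \<Longrightarrow> 2 ^ length (binary m) \<le> 2 * m"
proof (induction m rule: binary.induct)
  case (1 m)
  show ?case
  proof (cases "m < 2")
    case True
    with 1 show ?thesis by (subst binary.simps) simp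
  next
    case False
    with 1 have "2 ^ length (binary (m div 2)) \<le> 2 * (m div 2)" by simp
    then have "2 ^ length (binary (m div 2)) \<le> m" by linarith
    with False show ?thesis by (subst binary.simps) simp
  qed
qed

text \<open>The \<open>max 1\<close> covers \<open>m = 0\<close>, whose representation still takes
  one bit.\<close>

lemma length_binary_le: "real (length (binary m)) \<le> 1 + log 2 (max 1 (real m))"
proof (cases "m = 0")
  case True
  then show ?thesis by (simp add: binary.simps)
next
  case False
  then have "real (2 ^ length (binary m)) \<le> real (2 * m)"
    by (intro of_nat_mono power_length_binary_le) simp
  then have "2 powr real (length (binary m)) \<le> 2 * real m" by (simp add: powr_realpow)
  with False have "real (length (binary m)) \<le> log 2 (2 * real m)" by (subst le_log_iff) auto
  with False show ?thesis by (simp add: log_mult max_def)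
qed

lemma bit_imp_power_le:
  assumes "bit (l :: nat) x"
  shows "2 ^ x \<le> l"
proof -
  from assms have "l div 2 ^ x \<noteq> 0" by (metis bit_iff_odd even_zero)
  then show ?thesis by (simp add: div_eq_0_iff)
qed

lemma length_double_bits: "length (double_bits bs) = 2 * length bs"
  by (induction bs) (simp_all add: double_bits_def)

lemma length_Concat_Cons:
  "length (Concat (A # As)) = 2 * length A + (\<Sum>B\<leftarrow>As. 2 * length B + 2)"
  by (induction As arbitrary: A) (simp_all add: length_double_bits)

lemma bit_diff_index:
  assumes "l1 \<noteq> l2"
  shows "bit l1 (diff_index l1 l2) \<noteq> bit l2 (diff_index l1 l2)"
proof -
  from assms have "\<exists>x. bit l1 x \<noteq> bit l2 x" by (auto simp: bit_eq_iff)
  then show ?thesis unfolding diff_index_def by (rule LeastI_ex)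
qed

lemma length_binary_diff_index_le:
  assumes "l1 \<noteq> l2" "l1 \<in> {1..L}" "l2 \<in> {1..L}"
  shows "real (length (binary (diff_index l1 l2))) \<le> 1 + log 2 (log 2 (real L))"
proof -
  \<comment> \<open>Two distinct labels force this; it makes \<open>log 2 L\<close> at least 1,
    which absorbs the \<open>max 1\<close> of \<open>length_binary_le\<close>.\<close>
  from assms have "L \<ge> 2" by auto
  then have "log 2 (real L) \<ge> 1" by simp
  \<comment> \<open>One of the two labels has this bit set, and neither label exceeds
    \<open>L\<close>.\<close>
  have "2 ^ diff_index l1 l2 \<le> L"
    using bit_diff_index [OF assms(1)] assms(2,3) bit_imp_power_le le_trans by fastforce
  then have "real (2 ^ diff_index l1 l2) \<le> real L" by (rule of_nat_mono)
  then have "2 powr real (diff_index l1 l2) \<le> real L" by (simp add: powr_realpow)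
  with \<open>L \<ge> 2\<close> have "real (diff_index l1 l2) \<le> log 2 (real L)" by (subst le_log_iff) auto
  with \<open>log 2 (real L) \<ge> 1\<close>
  have "log 2 (max 1 (real (diff_index l1 l2))) \<le> log 2 (log 2 (real L))" by simp
  with length_binary_le [of "diff_index l1 l2"] show ?thesis by linarith
qed

text \<open>Concavity of the logarithm, in the form of its tangent at \<open>c\<close>.\<close>

lemma sum_log_le:
  fixes d :: "'a \<Rightarrow> real"
  assumes "\<And>i. i \<in> I \<Longrightarrow> 0 < d i" "(\<Sum>i\<in>I. d i) \<le> c * real (card I)" "0 < c"
  shows "(\<Sum>i\<in>I. log 2 (d i)) \<le> real (card I) * log 2 c"
proof -
  have "log 2 (d i) \<le> log 2 c + (d i / c - 1) / ln 2" if "i \<in> I" for i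
  proof -
    have "ln (d i / c) \<le> d i / c - 1"
      using assms(1) [OF that] \<open>0 < c\<close> by (intro ln_le_minus_one) simp
    then have "log 2 (d i / c) \<le> (d i / c - 1) / ln 2"
      by (simp add: log_def divide_right_mono)
    then show ?thesis using assms(1) [OF that] \<open>0 < c\<close> by (simp add: log_divide)
  qed
  then have "(\<Sum>i\<in>I. log 2 (d i)) \<le> (\<Sum>i\<in>I. log 2 c + (d i / c - 1) / ln 2)"
    by (rule sum_mono)
  also have "\<dots> = real (card I) * log 2 c + ((\<Sum>i\<in>I. d i) / c - real (card I)) / ln 2"
    by (simp add: sum.distrib sum_subtractf sum_divide_distrib [symmetric])
  \<comment> \<open>The average of the \<open>d i\<close> is at most \<open>c\<close>, so the linear
    terms of the tangents add up to at most 0.\<close>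
  also have "\<dots> \<le> real (card I) * log 2 c"
  proof -
    have "(\<Sum>i\<in>I. d i) / c \<le> real (card I)"
      using assms(2,3) by (simp add: field_simps)
    then show ?thesis by (simp add: divide_nonpos_pos)
  qed
  finally show ?thesis .
qed

section \<open>Shortest paths\<close>

lemma length_rev_path: "length (rev_path p) = length p"
  by (induction p) (simp_all add: rev_path_def)

lemma (in wf_digraph) awalk_cost_one: "awalk_cost (\<lambda>_. 1) p = real (length p)"
  by (induction p) simp_all

context pair_sym_digraph
begin

lemma graph_dist_le_length: "awalk u p v \<Longrightarrow> graph_dist G u v \<le> ereal (real (length p))"
  using min_cost_le_walk_cost [of u p v "\<lambda>_. 1"]
  by (simp add: graph_dist_def awalk_cost_one)

text \<open>Reversing a walk keeps its length. Symmetry is needed because \<open>D\<close> is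
  measured from \<open>a\<close> to \<open>b\<close>, whereas \<open>P\<close> leads from the second
  agent to the first.\<close>

lemma graph_dist_le_commute: "graph_dist G u v \<le> graph_dist G v u"
  unfolding graph_dist_def [of G v u] \<mu>_def
proof (rule INF_greatest)
  fix p assume "p \<in> {p. awalk v p u}"
  then have "awalk u (rev_path p) v" by simp
  then have "graph_dist G u v \<le> ereal (real (length (rev_path p)))"
    by (rule graph_dist_le_length)
  then show "graph_dist G u v \<le> ereal (awalk_cost (\<lambda>_. 1) p)"
    by (simp add: awalk_cost_one length_rev_path)
qed

lemma graph_dist_commute: "graph_dist G u v = graph_dist G v u"
  by (intro antisym graph_dist_le_commute)

lemma shortest_path_imp_awalk: "shortest_path G u P v \<Longrightarrow> awalk u P v"
  by (simp add: shortest_path_def apath_def)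

lemma shortest_path_length_le:
  assumes "shortest_path G u P v" "awalk u q v"
  shows "length P \<le> length q"
  using graph_dist_le_length [OF assms(2)] assms(1) by (simp add: shortest_path_def)

text \<open>A detour through \<open>w\<close> replaces the \<open>j - i\<close> arcs between the two
  vertices by two arcs, which must not shorten the path.\<close>

lemma shortest_path_common_neighbour:
  assumes P: "shortest_path G u P v" and "i < j" "j < length P"
    and arcs: "(fst (P ! i), w) \<in> parcs G" "(fst (P ! j), w) \<in> parcs G"
  shows "j \<le> i + 2"
proof -
  from P have w: "awalk u P v" by (rule shortest_path_imp_awalk)
  \<comment> \<open>\<open>awalk_append_iff\<close> is held back until the pieces have been folded
    into \<open>P\<close>; only then is the walk split at vertex \<open>i\<close>.\<close>
  have "awalk u (take i P @ P ! i # drop (Suc i) P) v"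
    using w assms by (simp add: id_take_nth_drop [symmetric] del: awalk_append_iff)
  then have 1: "awalk u (take i P) (fst (P ! i))"
    by (auto simp: awalk_Cons_iff)
  have "awalk u (take j P @ P ! j # drop (Suc j) P) v"
    using w assms by (simp add: id_take_nth_drop [symmetric] del: awalk_append_iff)
  then have 2: "awalk (fst (P ! j)) (drop j P) v"
    using \<open>j < length P\<close> by (auto simp: awalk_Cons_iff Cons_nth_drop_Suc [symmetric])
  from arcs(2) have "(w, fst (P ! j)) \<in> parcs G" by (rule arcs_symmetric)
  with arcs(1) 2 have "awalk (fst (P ! i)) ((fst (P ! i), w) # (w, fst (P ! j)) # drop j P) v"
    by (simp add: awalk_Cons_iff)
  with 1 have "awalk u (take i P @ (fst (P ! i), w) # (w, fst (P ! j)) # drop j P) v"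
    by (rule awalk_appendI)
  from shortest_path_length_le [OF P this] assms(2,3) show ?thesis by simp
qed

end

section \<open>Degree sum along a shortest path\<close>

lemma card_le_3_if_gaps_le_2:
  fixes S :: "nat set"
  assumes "\<And>i j. i \<in> S \<Longrightarrow> j \<in> S \<Longrightarrow> i < j \<Longrightarrow> j \<le> i + 2"
  shows "card S \<le> 3"
proof (cases "S = {}")
  case False
  define m where "m = (LEAST i. i \<in> S)"
  from False have m: "m \<in> S" unfolding m_def by (auto intro: LeastI)
  \<comment> \<open>Comparing with the minimum alone confines \<open>S\<close> to three consecutive
    numbers, and also shows it finite.\<close>
  have "S \<subseteq> {m..m + 2}"
  proof
    fix j assume "j \<in> S"
    then have "m \<le> j" unfolding m_def by (rule Least_le)
    with assms [OF m \<open>j \<in> S\<close>] show "j \<in> {m..m + 2}" by (cases "m = j") simp_all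
  qed
  from card_mono [OF _ this] show ?thesis by simp
qed simp

context pair_pseudo_graph
begin

text \<open>Arcs are pairs, so an arc leaving \<open>v\<close> is determined by its head. Counting
  heads prepares the double count below.\<close>

lemma out_degree_conv: "out_degree G v = card {w \<in> pverts G. (v, w) \<in> parcs G}"
proof -
  have "out_arcs G v = Pair v ` {w \<in> pverts G. (v, w) \<in> parcs G}"
    by (auto simp: out_arcs_def dest: in_arcsD2)
  then show ?thesis
    unfolding out_degree_def by (simp add: card_image inj_on_def)
qed

text \<open>Pairs of an index \<open>i\<close> and a neighbour \<open>w\<close> of the
  \<open>i\<close>-th vertex are counted by \<open>w\<close> instead: indices sharing a neighbour
  differ by at most 2, so each \<open>w\<close> occurs at most three times.\<close>

lemma sum_out_degree_shortest_path_le: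
  assumes P: "shortest_path G u P v"
  shows "(\<Sum>i<length P. out_degree G (fst (P ! i))) \<le> 3 * card (pverts G)"
proof -
  have "(\<Sum>i<length P. out_degree G (fst (P ! i)))
      = (\<Sum>w\<in>pverts G. card {i \<in> {..<length P}. (fst (P ! i), w) \<in> parcs G})"
    unfolding out_degree_conv
    by (rule sum_multicount_gen) (simp_all add: pair_finite_verts)
  also have "\<dots> \<le> (\<Sum>w\<in>pverts G. 3)"
  proof (rule sum_mono)
    fix w
    show "card {i \<in> {..<length P}. (fst (P ! i), w) \<in> parcs G} \<le> 3"
      using shortest_path_common_neighbour [OF P] by (intro card_le_3_if_gaps_le_2) auto
  qed
  finally show ?thesis by simp
qed

end

section \<open>Execution and advice length\<close>

text \<open>The algorithm reads the current round off the length of its percept list.\<close>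

lemma length_snd_run: "length (snd (run G port alg adv a k)) = Suc k"
  by (induction k) (auto simp: Let_def split: prod.splits action.splits)

lemma fast_rendezvous_advice:
  assumes "length h = Suc k"
  shows "fast_rendezvous l (advice port a b P) h =
    (if bit l (diff_index (label a) (label b)) \<and> k < length P then Move (port (P ! k)) else Stay)"
proof -
  have "Decode (advice port a b P) =
      binary (diff_index (label a) (label b)) # map (\<lambda>e. binary (port e)) P"
    unfolding advice_def by (rule Decode_Concat) simp
  then show ?thesis
    using assms by (simp add: fast_rendezvous_def Let_def nat_of_binary_binary comp_def)
qed

lemma run_fast_rendezvous_waiting:
  assumes "\<not> bit (label c) (diff_index (label a) (label b))"
  shows "fst (run G port fast_rendezvous (advice port a b P) c k) = start c"
proof (induction k)
  case (Suc k)
  have "fast_rendezvous (label c) (advice port a b P)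
      (snd (run G port fast_rendezvous (advice port a b P) c k)) = Stay"
    using assms by (simp add: fast_rendezvous_advice [OF length_snd_run])
  with Suc show ?case by (simp add: case_prod_beta Let_def)
qed simp

context port_graph
begin

lemma port_less_out_degree:
  assumes "e \<in> parcs G"
  shows "port e < out_degree G (fst e)"
  using bij_port [of "fst e"] assms arc_fst_in_verts by (auto simp: bij_betw_def)

lemma port_target_port:
  assumes "e \<in> parcs G"
  shows "port_target G port (fst e) (port e) = snd e"
proof -
  have "inj_on port (out_arcs G (fst e))"
    using bij_port [of "fst e"] assms arc_fst_in_verts by (auto simp: bij_betw_def)
  with assms have "(THE e'. e' \<in> out_arcs G (fst e) \<and> port e' = port e) = e"
    by (intro the_equality) (auto dest: inj_onD)
  then show ?thesis by (simp add: port_target_def)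
qed

text \<open>The \<open>min\<close> lets one induction cover both the walk and the rest at its
  end.\<close>

lemma run_fast_rendezvous_walking:
  assumes "bit (label c) (diff_index (label a) (label b))" "awalk (start c) P v"
  shows "fst (run G port fast_rendezvous (advice port a b P) c k)
    = pawalk_verts (start c) P ! min k (length P)"
proof (induction k)
  case 0
  from assms(2) show ?case using hd_conv_nth [of "pawalk_verts (start c) P"] by auto
next
  case (Suc k)
  let ?r = "run G port fast_rendezvous (advice port a b P) c k"
  have act: "fast_rendezvous (label c) (advice port a b P) (snd ?r) =
      (if k < length P then Move (port (P ! k)) else Stay)"
    using assms(1) by (simp add: fast_rendezvous_advice [OF length_snd_run])
  show ?case
  proof (cases "k < length P")
    case True
    then have e: "P ! k \<in> parcs G" using assms(2) by (auto simp: awalk_def)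
    \<comment> \<open>Vertex \<open>k\<close> of the walk is the tail of arc \<open>k\<close> and
      vertex \<open>k + 1\<close> is its head, so the port of \<open>P ! k\<close> leads from one to
      the other.\<close>
    have "fst ?r = fst (P ! k)"
      using Suc True by (auto simp: awalk_verts_conv nth_append)
    moreover have "pawalk_verts (start c) P ! Suc k = snd (P ! k)"
      using True assms(2) by (subst awalk_verts_conv' [of _ _ v]) auto
    ultimately show ?thesis
      using True act e
      by (simp add: case_prod_beta Let_def port_less_out_degree port_target_port)
  next
    case False
    with Suc act show ?thesis by (simp add: case_prod_beta Let_def)
  qed
qed

lemma run_fast_rendezvous_finished:
  assumes "bit (label c) (diff_index (label a) (label b))" "awalk (start c) P v" "length P \<le> k"
  shows "fst (run G port fast_rendezvous (advice port a b P) c k) = v"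
proof -
  have "pawalk_verts (start c) P ! length P = last (pawalk_verts (start c) P)"
    by (simp add: last_conv_nth length_awalk_verts)
  with assms show ?thesis by (auto simp: run_fast_rendezvous_walking min_absorb2)
qed

lemma fast_rendezvous_meets:
  assumes "label a \<noteq> label b"
    and P: "awalk (start (second_agent a b)) P (start (first_agent a b))"
  shows "rendezvous_in_time G port fast_rendezvous (advice port a b P) a b (length P)"
proof -
  let ?adv = "advice port a b P" and ?t = "max (wake a) (wake b) + length P"
  let ?f = "first_agent a b" and ?s = "second_agent a b" and ?x = "diff_index (label a) (label b)"
  have "bit (label ?s) ?x" "\<not> bit (label ?f) ?x"
    using bit_diff_index [OF assms(1)] by (auto simp: first_agent_def second_agent_def)
  \<comment> \<open>Whatever the wake-up order, the second agent is awake from the later wake-up on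
    and has had time for all of \<open>P\<close>.\<close>
  moreover have "length P \<le> ?t - wake ?s" by (auto simp: second_agent_def)
  ultimately have "position G port fast_rendezvous ?adv ?s ?t
      = position G port fast_rendezvous ?adv ?f ?t"
    using P by (simp add: position_def run_fast_rendezvous_finished run_fast_rendezvous_waiting)
  then have "position G port fast_rendezvous ?adv a ?t = position G port fast_rendezvous ?adv b ?t"
    by (simp add: first_agent_def second_agent_def split: if_splits)
  then show ?thesis unfolding rendezvous_in_time_def by (intro exI [of _ ?t]) simp
qed

text \<open>The 3 consists of one bit per port from \<open>length_binary_le\<close> and two from the
  factor 3 in the degree sum.\<close>

lemma sum_length_binary_port_le:
  assumes P: "shortest_path G u P v" and "P \<noteq> []"
  shows "(\<Sum>e\<leftarrow>P. real (length (binary (port e))))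
    \<le> real (length P) * (3 + log 2 (real (card (pverts G)) / real (length P)))"
proof -
  let ?D = "length P" and ?n = "card (pverts G)"
  let ?d = "\<lambda>i. out_degree G (fst (P ! i))"
  have arc: "P ! i \<in> parcs G" if "i < ?D" for i
    using shortest_path_imp_awalk [OF P] that by (auto simp: awalk_def)
  have "?D > 0" using assms(2) by simp
  have "?n > 0"
    using shortest_path_imp_awalk [OF P] pair_finite_verts by (auto simp: awalk_def card_gt_0_iff)
  have "real (length (binary (port (P ! i)))) \<le> 1 + log 2 (real (?d i))" if "i < ?D" for i
  proof -
    have "port (P ! i) < ?d i" using arc [OF that] by (rule port_less_out_degree)
    then have "log 2 (max 1 (real (port (P ! i)))) \<le> log 2 (real (?d i))" by simp
    with length_binary_le [of "port (P ! i)"] show ?thesis by linarith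
  qed
  then have "(\<Sum>i<?D. real (length (binary (port (P ! i))))) \<le> (\<Sum>i<?D. 1 + log 2 (real (?d i)))"
    by (intro sum_mono) simp
  also have "\<dots> = real ?D + (\<Sum>i<?D. log 2 (real (?d i)))" by (simp add: sum.distrib)
  \<comment> \<open>The tangent point \<open>3 * n / D\<close> is the bound on the average degree
    along \<open>P\<close>.\<close>
  also have "(\<Sum>i<?D. log 2 (real (?d i)))
      \<le> real (card {..<?D}) * log 2 (3 * real ?n / real ?D)"
  proof (rule sum_log_le)
    show "0 < real (?d i)" if "i \<in> {..<?D}" for i
      using port_less_out_degree [OF arc, of i] that by simp
    have "real (\<Sum>i<?D. ?d i) \<le> real (3 * ?n)"
      by (intro of_nat_mono sum_out_degree_shortest_path_le [OF P])
    with \<open>?D > 0\<close> show "(\<Sum>i<?D. real (?d i)) \<le> 3 * real ?n / real ?D * real (card {..<?D})"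
      by simp
  qed (use \<open>?n > 0\<close> \<open>?D > 0\<close> in simp)
  also have "real ?D + real (card {..<?D}) * log 2 (3 * real ?n / real ?D)
      \<le> real ?D * (3 + log 2 (real ?n / real ?D))"
  proof -
    \<comment> \<open>Rounding 3 up to 4 makes the additive constant an integer.\<close>
    have "log 2 (3 * real ?n / real ?D) \<le> log 2 (4 * (real ?n / real ?D))"
      using \<open>?n > 0\<close> \<open>?D > 0\<close> by (simp add: divide_right_mono)
    also have "\<dots> = 2 + log 2 (real ?n / real ?D)"
      using \<open>?n > 0\<close> \<open>?D > 0\<close> log_nat_power [of "2 :: real" 2 2]
      by (subst log_mult) auto
    finally have "real ?D * log 2 (3 * real ?n / real ?D)
        \<le> real ?D * (2 + log 2 (real ?n / real ?D))"
      by (rule mult_left_mono) simp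
    then show ?thesis by (simp add: algebra_simps)
  qed
  finally have "(\<Sum>i<?D. real (length (binary (port (P ! i)))))
      \<le> real ?D * (3 + log 2 (real ?n / real ?D))"
    by simp
  then show ?thesis by (simp add: sum_list_sum_nth atLeast0LessThan)
qed

text \<open>Every port costs at least four bits, doubled and with its separator, while
  \<open>log 2 (n / D)\<close> may be close to 0 on a long path; hence the
  \<open>max 1\<close>.\<close>

lemma length_advice_le:
  assumes "shortest_path G u P v" "P \<noteq> []"
    and "label a \<noteq> label b" "label a \<in> {1..L}" "label b \<in> {1..L}"
  shows "real (length (advice port a b P))
    \<le> 12 * (real (length P) * max 1 (log 2 (real (card (pverts G)) / real (length P)))
        + log 2 (log 2 (real L)))"
proof -
  let ?D = "real (length P)"
  let ?lg = "log 2 (real (card (pverts G)) / ?D)"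
  have "real (length (advice port a b P))
      = real (2 * length (binary (diff_index (label a) (label b)))
          + (\<Sum>e\<leftarrow>P. 2 * length (binary (port e)) + 2))"
    unfolding advice_def
    by (simp add: length_Concat_Cons comp_def)
  also have "\<dots> = 2 * real (length (binary (diff_index (label a) (label b))))
      + 2 * (\<Sum>e\<leftarrow>P. real (length (binary (port e)))) + 2 * ?D"
    by (induction P) simp_all
  also have "\<dots> \<le> 2 * (1 + log 2 (log 2 (real L))) + 2 * (?D * (3 + ?lg)) + 2 * ?D"
    using length_binary_diff_index_le [OF assms(3-5)] sum_length_binary_port_le [OF assms(1,2)]
    by (intro add_mono mult_left_mono) simp_all
  also have "\<dots> = 2 + 2 * log 2 (log 2 (real L)) + 8 * ?D + 2 * (?D * ?lg)"
    by (simp add: algebra_simps)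
  \<comment> \<open>With \<open>M = D * max 1 ?lg\<close>, the terms \<open>2\<close>,
    \<open>8 * D\<close> and \<open>2 * (D * ?lg)\<close> are at most \<open>2 * M\<close>,
    \<open>8 * M\<close> and \<open>2 * M\<close>, which gives 12. The iterated logarithm is
    nonnegative, so its factor may grow from 2 to 12.\<close>
  also have "\<dots> \<le> 12 * (?D * max 1 ?lg + log 2 (log 2 (real L)))"
  proof -
    have "?D \<ge> 1" using assms(2) by (cases P) simp_all
    moreover have "?D * 1 \<le> ?D * max 1 ?lg" "?D * ?lg \<le> ?D * max 1 ?lg"
      by (intro mult_left_mono; simp)+
    moreover have "L \<ge> 2" using assms(3-5) by auto
    then have "log 2 (log 2 (real L)) \<ge> 0" by simp
    ultimately show ?thesis by simp
  qed
  finally show ?thesis .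
qed

end

theorem theorem1:
  shows "\<exists>C > 0. \<forall>(G :: 'v pair_pre_digraph) (port :: 'v \<times> 'v \<Rightarrow> nat) (n :: nat) (D :: nat) (L :: nat)
      (a :: 'v agent) (b :: 'v agent) (P :: ('v \<times> 'v) list).
    port_graph G port \<longrightarrow>
    card (pverts G) = n \<longrightarrow>
    start a \<in> pverts G \<longrightarrow>
    start b \<in> pverts G \<longrightarrow>
    graph_dist G (start a) (start b) = ereal (real D) \<longrightarrow>
    D \<ge> 1 \<longrightarrow>
    label a \<in> {1..L} \<longrightarrow>
    label b \<in> {1..L} \<longrightarrow>
    label a \<noteq> label b \<longrightarrow>
    shortest_path G (start (second_agent a b)) P (start (first_agent a b)) \<longrightarrow>
    rendezvous_in_time G port fast_rendezvous (advice port a b P) a b D \<and>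
    real (length (advice port a b P))
      \<le> C * (real D * max 1 (log 2 (real n / real D)) + log 2 (log 2 (real L)))"
proof (rule exI [of _ 12], intro conjI [OF zero_less_numeral] allI impI)
  fix G :: "'v pair_pre_digraph" and port :: "'v \<times> 'v \<Rightarrow> nat" and n D L :: nat
    and a b :: "'v agent" and P :: "('v \<times> 'v) list"
  assume "port_graph G port" and n: "card (pverts G) = n"
    and dist: "graph_dist G (start a) (start b) = ereal (real D)" and "D \<ge> 1"
    and labels: "label a \<in> {1..L}" "label b \<in> {1..L}" "label a \<noteq> label b"
    and P: "shortest_path G (start (second_agent a b)) P (start (first_agent a b))"
  from \<open>port_graph G port\<close> interpret port_graph G port .
  \<comment> \<open>Either of \<open>a\<close> and \<open>b\<close> may be the second agent;
    symmetry of the distance gives length \<open>D\<close> in both cases.\<close>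
  have "graph_dist G (start (second_agent a b)) (start (first_agent a b)) = ereal (real D)"
    using dist by (simp add: first_agent_def second_agent_def graph_dist_commute [of "start b"])
  with P have D: "length P = D" by (simp add: shortest_path_def)
  with \<open>D \<ge> 1\<close> have "P \<noteq> []" by auto
  show "rendezvous_in_time G port fast_rendezvous (advice port a b P) a b D \<and>
    real (length (advice port a b P))
      \<le> 12 * (real D * max 1 (log 2 (real n / real D)) + log 2 (log 2 (real L)))"
    using fast_rendezvous_meets [OF labels(3) shortest_path_imp_awalk [OF P]]
      length_advice_le [OF P \<open>P \<noteq> []\<close> labels(3,1,2)]
    by (simp add: D n)
qed

end
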